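(* Let $\mathfrak{t}=(t_1,\ldots,t_n)\in\mathbb{R}^n$ with $t_1<t_2<\cdots<t_n$, let $T=(T_1,\ldots,T_n)\in\mathbb{R}^n$ and let $k\in\mathbb{R}$. Assume that $T$ (with this $k$) is in case 1 and that the best approximation of $T$ in $\mathcal{F}_k$ with respect to the max-norm exists. Then the procedure of successively approximating the remainders (described in the context) locates, in a finite number of steps, the best approximation of $T$ in $\mathcal{F}_k$.
   Context: For a function $f:\mathbb{R}\to\mathbb{R}$ write $f(\mathfrak{t})=(f(t_1),\ldots,f(t_n))$. For $k\in\mathbb{R}$, $\mathcal{F}_k=\{f(\mathfrak{t}) : f(t)=\alpha e^{kt}+\beta,\ \alpha,\beta\in\mathbb{R}\}\subset\mathbb{R}^n$. On $\mathbb{R}^n$, $\|v\|_\infty=\max_i|v_i|$. An element $f(\mathfrak{t})\in\mathcal{F}_k$ is the best approximation of $T$ in $\mathcal{F}_k$ if $\|T-f(\mathfrak{t})\|_\infty<\|T-g(\mathfrak{t})\|_\infty$ for every $g(\mathfrak{t})\in\mathcal{F}_k$ with $g(\mathfrak{t})\ne f(\mathfrak{t})$. Maximum and minimum always mean global maximum and minimum of the coordinates of a vector. A vector $X\in\mathbb{R}^n$ is alternated if either there are indices $M_1<m_1<M_2$ with $X_{M_1}=X_{M_2}=\max X$ and $X_{m_1}=\min X$, or there are indices $m_1<M_1<m_2$ with $X_{m_1}=X_{m_2}=\min X$ and $X_{M_1}=\max X$. A vector $X$ (with the given $k$) is in case 1 if $k<0$, $X$ is not alternated, and the maxima of $X$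 are attained before its minima (every index at which $\max X$ is attained is smaller than every index at which $\min X$ is attained). Construction of $I_X$ (for $X$ in case 1): let $m$ be the first index with $X_m=\min X$ and $M$ the last index with $X_M=\max X$ (so $M<m$). For $i\neq j$ put $a_{ij}=\dfrac{X_i-X_j}{e^{kt_i}-e^{kt_j}}$. Put $a=\min\big(\{a_{im}: i<m\}\cup\{a_{jM}: j>M\}\big)$, $b_m=X_m-ae^{kt_m}$, $b_M=X_M-ae^{kt_M}$, and $I_X(t)=ae^{kt}+\frac{b_m+b_M}{2}$. If $a=a_{mM}$, then $I_X(\mathfrak{t})=X$, that is, $I_X$ interpolates $X$, and the approximation problem is already solved. Procedure of successively approximating the remainders ($k$ is kept fixed): start with the remainder $R^{(0)}=T$ and keep replacing the current remainder $R^{(s)}$ by $R^{(s+1)}=R^{(s)}-I_{R^{(s)}}(\mathfrak{t})$ until an alternated remainder is reached (or, as noted above, the remainder has been interpolated exactly, so that the problem is already solved). The output is the sum of the exponentials $I_{R^{(0)}}+I_{R^{(1)}}+\cdots$ obtained along the way, evaluated at $\mathfrak{t}$. *)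

theory Defs
  imports "HOL-Analysis.Analysis"
begin

text \<open>
  The space of vectors with \<open>n\<close> real coordinates is \<^typ>\<open>real ^ 'n\<close> for a finite linearly
  ordered index type \<open>'n\<close> with \<open>n\<close> elements; the order of \<open>'n\<close> is the order of the
  coordinates. The max-norm is the library's \<^const>\<open>infnorm\<close>.
\<close>

lemma infnorm_eq_Max: "infnorm v = Max (range (\<lambda>i. \<bar>v $ i\<bar>))" for v :: "real ^ 'n"
proof -
  have "{\<bar>v $ i\<bar> | i. i \<in> UNIV} = range (\<lambda>i. \<bar>v $ i\<bar>)" by auto
  then show ?thesis by (simp add: infnorm_cart cSup_eq_Max)
qed

definition sample :: "(real \<Rightarrow> real) \<Rightarrow> real ^ 'n \<Rightarrow> real ^ 'n" where
  "sample f t = (\<chi> i. f (t $ i))"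

definition exp_space :: "real \<Rightarrow> real ^ 'n \<Rightarrow> (real ^ 'n) set" where
  "exp_space k t = {sample f t | f. \<exists>\<alpha> \<beta>. f = (\<lambda>x. \<alpha> * exp (k * x) + \<beta>)}"

definition best_approximation :: "real \<Rightarrow> real ^ 'n \<Rightarrow> real ^ 'n \<Rightarrow> real ^ 'n \<Rightarrow> bool" where
  "best_approximation k t T v \<longleftrightarrow>
     v \<in> exp_space k t \<and>
     (\<forall>w \<in> exp_space k t. w \<noteq> v \<longrightarrow> infnorm (T - v) < infnorm (T - w))"

definition vmax :: "real ^ 'n \<Rightarrow> real" where
  "vmax X = Max (range (\<lambda>i. X $ i))"

definition vmin :: "real ^ 'n \<Rightarrow> real" where
  "vmin X = Min (range (\<lambda>i. X $ i))"

definition alternated :: "real ^ 'n::{finite,linorder} \<Rightarrow> bool" where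
  "alternated X \<longleftrightarrow>
     (\<exists>M1 m1 M2. M1 < m1 \<and> m1 < M2 \<and>
        X $ M1 = vmax X \<and> X $ M2 = vmax X \<and> X $ m1 = vmin X) \<or>
     (\<exists>m1 M1 m2. m1 < M1 \<and> M1 < m2 \<and>
        X $ m1 = vmin X \<and> X $ m2 = vmin X \<and> X $ M1 = vmax X)"

definition in_case1 :: "real \<Rightarrow> real ^ 'n::{finite,linorder} \<Rightarrow> bool" where
  "in_case1 k X \<longleftrightarrow>
     k < 0 \<and> \<not> alternated X \<and> (\<forall>i j. X $ i = vmax X \<longrightarrow> X $ j = vmin X \<longrightarrow> i < j)"

definition first_min :: "real ^ 'n::{finite,linorder} \<Rightarrow> 'n::{finite,linorder}" where
  "first_min X = Min {i. X $ i = vmin X}"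

definition last_max :: "real ^ 'n::{finite,linorder} \<Rightarrow> 'n::{finite,linorder}" where
  "last_max X = Max {i. X $ i = vmax X}"

definition slope :: "real \<Rightarrow> real ^ 'n \<Rightarrow> real ^ 'n \<Rightarrow> 'n \<Rightarrow> 'n \<Rightarrow> real" where
  "slope k t X i j = (X $ i - X $ j) / (exp (k * t $ i) - exp (k * t $ j))"

text \<open>
  The next two definitions are meaningful for \<open>X\<close> in case 1 and strictly increasing \<open>t\<close>:
  then \<open>last_max X < first_min X\<close>, so the minimum is over a nonempty set.
\<close>

definition min_slope ::
    "real \<Rightarrow> real ^ 'n::{finite,linorder} \<Rightarrow> real ^ 'n::{finite,linorder} \<Rightarrow> real" where
  "min_slope k t X =
     Min ({slope k t X i (first_min X) | i. i < first_min X} \<union>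
          {slope k t X j (last_max X) | j. j > last_max X})"

definition I_fun ::
    "real \<Rightarrow> real ^ 'n::{finite,linorder} \<Rightarrow> real ^ 'n::{finite,linorder} \<Rightarrow> real \<Rightarrow> real" where
  "I_fun k t X =
     (let a = min_slope k t X;
          b_m = X $ first_min X - a * exp (k * t $ first_min X);
          b_M = X $ last_max X - a * exp (k * t $ last_max X)
      in (\<lambda>x. a * exp (k * x) + (b_m + b_M) / 2))"

primrec remainder ::
    "real \<Rightarrow> real ^ 'n::{finite,linorder} \<Rightarrow> real ^ 'n::{finite,linorder} \<Rightarrow> nat \<Rightarrow> real ^ 'n::{finite,linorder}" where
  "remainder k t T 0 = T"
| "remainder k t T (Suc s) =
     remainder k t T s - sample (I_fun k t (remainder k t T s)) t"

text \<open>
  The zero remainder is the case of exact interpolation; it has to be listed because with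
  two coordinates it is not alternated.
\<close>

definition finished :: "real ^ 'n::{finite,linorder} \<Rightarrow> bool" where
  "finished R \<longleftrightarrow> alternated R \<or> R = 0"

text \<open>
  \<^const>\<open>remainder\<close> is a total sequence. The procedure performs exactly \<open>N\<close> steps if the
  \<open>N\<close>-th remainder is the first one at which it has to stop and every remainder before that
  is in case 1, so that every step taken is an admissible one.
\<close>

definition procedure_stops_after ::
    "real \<Rightarrow> real ^ 'n::{finite,linorder} \<Rightarrow> real ^ 'n::{finite,linorder} \<Rightarrow> nat \<Rightarrow> bool" where
  "procedure_stops_after k t T N \<longleftrightarrow>
     finished (remainder k t T N) \<and>
     (\<forall>s<N. \<not> finished (remainder k t T s) \<and> in_case1 k (remainder k t T s))"

definition procedure_output ::
    "real \<Rightarrow> real ^ 'n::{finite,linorder} \<Rightarrow> real ^ 'n::{finite,linorder} \<Rightarrow> nat \<Rightarrow> real ^ 'n::{finite,linorder}" where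
  "procedure_output k t T N =
     sample (\<lambda>x. \<Sum>s<N. I_fun k t (remainder k t T s) x) t"

end

theory Submission imports Defs begin

text \<open>
  Put \<open>x\<^sub>i = exp (k t\<^sub>i)\<close>, which decreases in \<open>i\<close> because \<open>k < 0\<close>. The choice of \<open>a\<close> as
  a minimum of slopes makes the last maximum \<open>M\<close> and the first minimum \<open>m\<close> of \<open>X\<close> a maximum
  and a minimum of \<open>X - a x\<close> too, while some further coordinate before \<open>m\<close> or after \<open>M\<close>
  becomes extremal. Hence the remainder is zero, or alternated, or again in case 1 with a
  strictly smaller index interval from its last maximum to its first minimum, so the procedure
  stops. The centred remainder has opposite extremes, and if it is alternated, no nonzero
  \<open>\<alpha> x + \<beta>\<close> can be subtracted without enlarging its norm: such a vector would have to be weakly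
  positive, negative, positive (or the reverse) along three increasing indices, although it
  is strictly monotone or constant.
\<close>

section \<open>Extremal coordinates of a vector\<close>

lemma vmax_ge: "X $ i \<le> vmax X"
  by (simp add: vmax_def)

lemma vmin_le: "vmin X \<le> X $ i"
  by (simp add: vmin_def)

lemma vmax_eqI: "(\<And>i. X $ i \<le> X $ j) \<Longrightarrow> vmax X = X $ j"
  unfolding vmax_def by (rule Max_eqI) auto

lemma vmin_eqI: "(\<And>i. X $ j \<le> X $ i) \<Longrightarrow> vmin X = X $ j"
  unfolding vmin_def by (rule Min_eqI) auto

lemma nth_last_max: "X $ last_max X = vmax X"
proof -
  have "vmax X \<in> range (\<lambda>i. X $ i)"
    unfolding vmax_def by (rule Max_in) auto
  then have "{i. X $ i = vmax X} \<noteq> {}" by auto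
  from Max_in[OF _ this] show ?thesis by (simp add: last_max_def)
qed

lemma nth_first_min: "X $ first_min X = vmin X"
proof -
  have "vmin X \<in> range (\<lambda>i. X $ i)"
    unfolding vmin_def by (rule Min_in) auto
  then have "{i. X $ i = vmin X} \<noteq> {}" by auto
  from Min_in[OF _ this] show ?thesis by (simp add: first_min_def)
qed

lemma last_max_ge: "X $ i = vmax X \<Longrightarrow> i \<le> last_max X"
  by (simp add: last_max_def)

lemma first_min_le: "X $ i = vmin X \<Longrightarrow> first_min X \<le> i"
  by (simp add: first_min_def)

lemma less_vmax: "last_max X < j \<Longrightarrow> X $ j < vmax X"
  using vmax_ge[of X j] last_max_ge[of X j] by (auto simp: less_le)

lemma vmin_less: "i < first_min X \<Longrightarrow> vmin X < X $ i"
  using vmin_le[of X i] first_min_le[of X i] by (auto simp: less_le)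

lemma last_max_less_first_min: "in_case1 k X \<Longrightarrow> last_max X < first_min X"
  by (simp add: in_case1_def nth_last_max nth_first_min)

lemma infnorm_le_iff: "infnorm v \<le> r \<longleftrightarrow> (\<forall>i. \<bar>v $ i\<bar> \<le> r)" for v :: "real ^ 'n"
  by (simp add: infnorm_eq_Max)

section \<open>One step of the procedure\<close>

lemma min_slope_properties:
  assumes case1: "in_case1 k X"
  shows "i < first_min X \<Longrightarrow> min_slope k t X \<le> slope k t X i (first_min X)"
    and "last_max X < j \<Longrightarrow> min_slope k t X \<le> slope k t X j (last_max X)"
    and "(\<exists>i<first_min X. min_slope k t X = slope k t X i (first_min X)) \<or>
         (\<exists>j>last_max X. min_slope k t X = slope k t X j (last_max X))"
proof -
  let ?S = "{slope k t X i (first_min X) | i. i < first_min X} \<union>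
            {slope k t X j (last_max X) | j. j > last_max X}"
  have fin: "finite ?S" by (auto simp: setcompr_eq_image)
  have "?S \<noteq> {}" using last_max_less_first_min[OF case1] by auto
  with fin have "min_slope k t X \<in> ?S" unfolding min_slope_def by (rule Min_in)
  then show "(\<exists>i<first_min X. min_slope k t X = slope k t X i (first_min X)) \<or>
         (\<exists>j>last_max X. min_slope k t X = slope k t X j (last_max X))" by blast
  have le: "min_slope k t X \<le> s" if "s \<in> ?S" for s
    unfolding min_slope_def using fin that by (rule Min_le)
  show "i < first_min X \<Longrightarrow> min_slope k t X \<le> slope k t X i (first_min X)" by (rule le) blast
  show "last_max X < j \<Longrightarrow> min_slope k t X \<le> slope k t X j (last_max X)" by (rule le) blast
qed

text \<open>Subtracting \<open>a * x\<close> preserves the extremality of \<open>M\<close> and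
  \<open>m\<close>: on one side of each index because \<open>a\<close> is at most the relevant
  slopes, on the other because \<open>a > 0\<close> and \<open>x\<close> decreases. A slope equal to
  \<open>a\<close> creates the further extremal coordinate, and the averaged constant term makes the
  extremes opposite.\<close>

lemma remainder_step:
  fixes t X :: "real ^ 'n::{finite,linorder}"
  assumes mono: "\<forall>i j. i < j \<longrightarrow> t $ i < t $ j"
    and case1: "in_case1 k X"
  defines "R \<equiv> X - sample (I_fun k t X) t"
  shows "R $ last_max X = vmax R"
    and "R $ first_min X = vmin R"
    and "vmax R = - vmin R"
    and "(\<exists>i<first_min X. R $ i = vmin R) \<or> (\<exists>j>last_max X. R $ j = vmax R)"
proof -
  define M m where "M = last_max X" and "m = first_min X"
  define x where "x i = exp (k * t $ i)" for i
  define a where "a = min_slope k t X"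
  have "k < 0" using case1 by (simp add: in_case1_def)
  then have x_less: "x j < x i" if "i < j" for i j
    using mono that by (simp add: x_def)
  have Mm: "M < m" using last_max_less_first_min[OF case1] by (simp add: M_def m_def)
  have XM: "X $ M = vmax X" and Xm: "X $ m = vmin X"
    by (simp_all add: M_def m_def nth_last_max nth_first_min)
  have slope: "slope k t X i j = (X $ i - X $ j) / (x i - x j)" for i j
    by (simp add: slope_def x_def)
  \<comment> \<open>As \<open>m\<close> is the first minimum and \<open>M\<close> the last maximum,
    the numerators are nonzero: both parts of the quotient are positive before \<open>m\<close>,
    both negative after \<open>M\<close>.\<close>
  have slope_m_pos: "0 < slope k t X i m" if "i < m" for i
    using vmin_less[of i X] that x_less[OF that] by (simp add: slope Xm flip: m_def)
  have slope_M_pos: "0 < slope k t X j M" if "M < j" for j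
    using less_vmax[of X j] that x_less[OF that]
    by (simp add: slope XM divide_neg_neg flip: M_def)
  note props = min_slope_properties[OF case1, where t = t, folded a_def M_def m_def]
  have "0 < a" using props(3) slope_m_pos slope_M_pos by auto
  have R: "R $ i = X $ i - a * x i - ((X $ m - a * x m) + (X $ M - a * x M)) / 2" for i
    by (simp add: R_def sample_def I_fun_def Let_def a_def x_def M_def m_def)
  have R_ge: "R $ m \<le> R $ i" for i
  proof (cases "i < m")
    case True
    with props(1)[OF True] show ?thesis
      using x_less[OF True] by (simp add: R slope pos_le_divide_eq algebra_simps)
  next
    case False
    then have "x i \<le> x m" using x_less[of m i] by (cases i m rule: linorder_cases) auto
    then have "a * x i \<le> a * x m" using \<open>0 < a\<close> by simp
    then show ?thesis using vmin_le[of X i] by (simp add: R Xm)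
  qed
  \<comment> \<open>Mirror image of \<open>R_ge\<close>, except that clearing the negative
    denominator \<open>x i - x M\<close> reverses the inequality.\<close>
  have R_le: "R $ i \<le> R $ M" for i
  proof (cases "M < i")
    case True
    with props(2)[OF True] show ?thesis
      using x_less[OF True] by (simp add: R slope neg_le_divide_eq algebra_simps)
  next
    case False
    then have "x M \<le> x i" using x_less[of i M] by (cases i M rule: linorder_cases) auto
    then have "a * x M \<le> a * x i" using \<open>0 < a\<close> by simp
    then show ?thesis using vmax_ge[of X i] by (simp add: R XM)
  qed
  have vmax: "vmax R = R $ M" and vmin: "vmin R = R $ m"
    using R_le R_ge by (auto intro: vmax_eqI vmin_eqI)
  then show "R $ last_max X = vmax R" "R $ first_min X = vmin R"
    by (simp_all add: M_def m_def)
  show "vmax R = - vmin R" by (simp add: vmax vmin R field_simps)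
  have "R $ i = R $ m" if "i < m" "a = slope k t X i m" for i
  proof -
    have "a * (x i - x m) = X $ i - X $ m" using x_less[OF that(1)] that(2) by (simp add: slope)
    then show ?thesis by (simp add: R algebra_simps)
  qed
  moreover have "R $ j = R $ M" if "M < j" "a = slope k t X j M" for j
  proof -
    have "a * (x j - x M) = X $ j - X $ M" using x_less[OF that(1)] that(2) by (simp add: slope)
    then show ?thesis by (simp add: R algebra_simps)
  qed
  ultimately show "(\<exists>i<first_min X. R $ i = vmin R) \<or> (\<exists>j>last_max X. R $ j = vmax R)"
    using props(3) unfolding vmax vmin M_def m_def by blast
qed

lemma unfinished_remainder_step:
  fixes t X :: "real ^ 'n::{finite,linorder}"
  assumes mono: "\<forall>i j. i < j \<longrightarrow> t $ i < t $ j"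
    and case1: "in_case1 k X"
  defines "R \<equiv> X - sample (I_fun k t X) t"
  assumes unfinished: "\<not> finished R"
  shows "in_case1 k R"
    and "card {last_max R..first_min R} < card {last_max X..first_min X}"
proof -
  define M m where "M = last_max X" and "m = first_min X"
  note step = remainder_step[OF mono case1, folded R_def, folded M_def m_def]
  have "M < m" using last_max_less_first_min[OF case1] by (simp add: M_def m_def)
  have not_alt: "\<not> alternated R" and "R \<noteq> 0" using unfinished by (auto simp: finished_def)
  \<comment> \<open>A constant vector with opposite extremes is zero.\<close>
  have neq: "vmax R \<noteq> vmin R"
  proof
    assume "vmax R = vmin R"
    then have "R $ i = 0" for i
      using step(3) vmax_ge[of R i] vmin_le[of R i] by linarith
    with \<open>R \<noteq> 0\<close> show False by (simp add: vec_eq_iff)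
  qed
  \<comment> \<open>A minimum \<open>j\<close> before a maximum \<open>i\<close> yields alternation:
    \<open>j\<close>, \<open>M\<close>, \<open>m\<close> if \<open>j < M\<close>, and
    \<open>M\<close>, \<open>j\<close>, \<open>i\<close> if \<open>M < j\<close>.\<close>
  have before: "i < j" if i: "R $ i = vmax R" and j: "R $ j = vmin R" for i j
  proof (rule ccontr)
    assume "\<not> i < j"
    moreover have "i \<noteq> j" "j \<noteq> M" using i j step(1) neq by auto
    ultimately have "j < i" and "j < M \<or> M < j" by auto
    then have "alternated R"
      using i j step(1,2) \<open>M < m\<close> unfolding alternated_def by blast
    with not_alt show False ..
  qed
  then show "in_case1 k R"
    using case1 not_alt by (auto simp: in_case1_def)
  from this have less: "last_max R < first_min R" by (rule last_max_less_first_min)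
  have ge: "M \<le> last_max R" and le: "first_min R \<le> m"
    using step(1,2) by (auto intro: last_max_ge first_min_le)
  \<comment> \<open>The further extremal coordinate moves at least one end of the interval strictly
    inwards.\<close>
  have "M < last_max R \<or> first_min R < m"
    using step(4) last_max_ge[of R] first_min_le[of R] by (meson le_less_trans less_le_trans)
  then have "{last_max R..first_min R} \<subset> {M..m}"
    using ge le less by (subst atLeastatMost_psubset_iff) auto
  then show "card {last_max R..first_min R} < card {last_max X..first_min X}"
    unfolding M_def m_def by (rule psubset_card_mono[rotated]) simp
qed

lemma in_case1_unfinished:
  assumes "in_case1 k X"
  shows "\<not> finished X"
proof -
  have "X \<noteq> 0"
    using last_max_less_first_min[OF assms] less_vmax[of X "first_min X"] nth_last_max[of X]
    by auto
  then show ?thesis using assms by (simp add: finished_def in_case1_def)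
qed

text \<open>The interval length \<open>?gap\<close> is a natural number that drops at every
  unfinished step. \<open>N > 0\<close> is recorded because it is a step that makes a remainder
  centred.\<close>

lemma procedure_stops:
  fixes t T :: "real ^ 'n::{finite,linorder}"
  assumes mono: "\<forall>i j. i < j \<longrightarrow> t $ i < t $ j"
    and case1: "in_case1 k T"
  shows "\<exists>N>0. procedure_stops_after k t T N"
proof -
  let ?R = "remainder k t T"
  let ?gap = "\<lambda>s. card {last_max (?R s)..first_min (?R s)}"
  have all_case1: "in_case1 k (?R s)" if "\<And>r. r \<le> s \<Longrightarrow> \<not> finished (?R r)" for s
    using that
  proof (induction s)
    case (Suc s)
    then show ?case
      using unfinished_remainder_step(1)[OF mono, of k "?R s"] Suc.prems[of "Suc s"] by simp
  qed (simp add: case1)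
  have "\<exists>N. finished (?R N)"
  proof (rule ccontr)
    assume "\<nexists>N. finished (?R N)"
    then have unf: "\<not> finished (?R s)" for s by blast
    then have "?gap (Suc s) < ?gap s" for s
      using unfinished_remainder_step(2)[OF mono all_case1, of s] unf[of "Suc s"] by simp
    then show False using wf_no_infinite_down_chainE[OF wf_less, of ?gap] by blast
  qed
  \<comment> \<open>The least such \<open>N\<close>, so that all earlier remainders are unfinished
    and hence in case 1.\<close>
  then obtain N where N: "finished (?R N)" "\<And>s. s < N \<Longrightarrow> \<not> finished (?R s)"
    using exists_least_iff[of "\<lambda>N. finished (?R N)"] by blast
  then have "procedure_stops_after k t T N"
    using all_case1 by (auto simp: procedure_stops_after_def)
  moreover have "N > 0" using N(1) in_case1_unfinished[OF case1] by (cases N) auto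
  ultimately show ?thesis by blast
qed

section \<open>Optimality of the output\<close>

lemma remainder_eq: "remainder k t T N = T - procedure_output k t T N"
  by (induction N) (simp_all add: procedure_output_def sample_def vec_eq_iff)

text \<open>All steps share the same \<open>k\<close>, so the coefficients simply add up.\<close>

lemma procedure_output_in_exp_space: "procedure_output k t T N \<in> exp_space k t"
proof -
  have "\<forall>s. \<exists>\<alpha> \<beta>. \<forall>x. I_fun k t (remainder k t T s) x = \<alpha> * exp (k * x) + \<beta>"
    by (auto simp: I_fun_def Let_def)
  then obtain \<alpha> \<beta> where "\<And>s x. I_fun k t (remainder k t T s) x = \<alpha> s * exp (k * x) + \<beta> s"
    by metis
  then have "(\<lambda>x. \<Sum>s<N. I_fun k t (remainder k t T s) x) =
      (\<lambda>x. (\<Sum>s<N. \<alpha> s) * exp (k * x) + (\<Sum>s<N. \<beta> s))"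
    by (simp add: sum.distrib sum_distrib_right)
  then show ?thesis unfolding procedure_output_def exp_space_def by blast
qed

lemma affine_sign_changes_zero:
  fixes \<alpha> \<beta> u v w :: real
  assumes "u > v" "v > w"
    and "\<alpha> * u + \<beta> \<ge> 0" "\<alpha> * v + \<beta> \<le> 0" "\<alpha> * w + \<beta> \<ge> 0"
  shows "\<alpha> = 0 \<and> \<beta> = 0"
proof -
  \<comment> \<open>Differences of consecutive sign conditions force \<alpha> to be both nonnegative
    and nonpositive.\<close>
  have "\<alpha> * (u - v) \<ge> 0" "\<alpha> * (v - w) \<le> 0" using assms by (auto simp: algebra_simps)
  then have "\<alpha> = 0" using assms(1,2) by (auto simp: zero_le_mult_iff mult_le_0_iff)
  then show ?thesis using assms by simp
qed

lemma best_approximation_of_alternated: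
  fixes t T v :: "real ^ 'n::{finite,linorder}"
  assumes mono: "\<forall>i j. i < j \<longrightarrow> t $ i < t $ j" and "k < 0"
    and v: "v \<in> exp_space k t"
    and alt: "alternated (T - v)" and centred: "vmax (T - v) = - vmin (T - v)"
  shows "best_approximation k t T v"
proof -
  define r where "r = vmax (T - v)"
  define x where "x i = exp (k * t $ i)" for i
  have x_less: "x j < x i" if "i < j" for i j
    using mono that \<open>k < 0\<close> by (simp add: x_def)
  have norm_le: "infnorm (T - v) \<le> r"
    using vmax_ge[of "T - v"] vmin_le[of "T - v"] centred
    by (auto simp: infnorm_le_iff r_def abs_le_iff minus_le_iff simp del: vector_minus_component)
  have "w = v" if w: "w \<in> exp_space k t" and le: "infnorm (T - w) \<le> infnorm (T - v)" for w
  proof -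
    obtain \<alpha>1 \<beta>1 \<alpha>2 \<beta>2 where "v = sample (\<lambda>y. \<alpha>1 * exp (k * y) + \<beta>1) t"
      and "w = sample (\<lambda>y. \<alpha>2 * exp (k * y) + \<beta>2) t"
      using v w by (auto simp: exp_space_def)
    then have eq: "w $ i - v $ i = (\<alpha>2 - \<alpha>1) * x i + (\<beta>2 - \<beta>1)" for i
      by (simp add: sample_def x_def algebra_simps)
    have bound: "\<bar>T $ i - w $ i\<bar> \<le> r" for i
      using le norm_le infnorm_le_iff[of "T - w" r] by auto
    \<comment> \<open>Where \<open>T - v\<close> equals \<open>r\<close>, the bound on
      \<open>T - w\<close> allows \<open>w\<close> only to lie above \<open>v\<close>; where it
      equals \<open>- r\<close>, only below.\<close>
    have pos: "w $ i - v $ i \<ge> 0" if "(T - v) $ i = vmax (T - v)" for i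
      using bound[of i] that by (simp add: r_def)
    have neg: "w $ i - v $ i \<le> 0" if "(T - v) $ i = vmin (T - v)" for i
      using bound[of i] that centred by (simp add: r_def)
    define \<alpha> \<beta> where "\<alpha> = \<alpha>2 - \<alpha>1" and "\<beta> = \<beta>2 - \<beta>1"
    note eq = eq[folded \<alpha>_def \<beta>_def]
    have "\<alpha> = 0 \<and> \<beta> = 0"
      using alt unfolding alternated_def
    proof (elim disjE exE conjE)
      fix i j l assume ijl: "i < j" "j < l" "(T - v) $ i = vmax (T - v)"
        "(T - v) $ l = vmax (T - v)" "(T - v) $ j = vmin (T - v)"
      show ?thesis
        using pos[OF ijl(3)] pos[OF ijl(4)] neg[OF ijl(5)] unfolding eq
        by (intro affine_sign_changes_zero[OF x_less[OF ijl(1)] x_less[OF ijl(2)]])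
    next
      fix i j l assume ijl: "i < j" "j < l" "(T - v) $ i = vmin (T - v)"
        "(T - v) $ l = vmin (T - v)" "(T - v) $ j = vmax (T - v)"
      \<comment> \<open>The opposite sign pattern reduces to the first one by negation.\<close>
      have "- \<alpha> = 0 \<and> - \<beta> = 0"
        using neg[OF ijl(3)] neg[OF ijl(4)] pos[OF ijl(5)] unfolding eq
        by (intro affine_sign_changes_zero[OF x_less[OF ijl(1)] x_less[OF ijl(2)]]) auto
      then show ?thesis by simp
    qed
    then show "w = v" using eq by (simp add: vec_eq_iff)
  qed
  then show ?thesis using v by (force simp: best_approximation_def not_less)
qed

lemma best_approximation_self: "T \<in> exp_space k t \<Longrightarrow> best_approximation k t T T"
  by (auto simp: best_approximation_def infnorm_0 infnorm_pos_lt)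

theorem theorem2p8:
  fixes t T :: "real ^ 'n::{finite,linorder}" and k :: real
  assumes "\<forall>i j. i < j \<longrightarrow> t $ i < t $ j"
    and "in_case1 k T"
    and "\<exists>v. best_approximation k t T v"
  shows "\<exists>N. procedure_stops_after k t T N \<and>
             best_approximation k t T (procedure_output k t T N)"
proof -
  obtain N where N: "N > 0" "procedure_stops_after k t T N"
    using procedure_stops[OF assms(1,2)] by blast
  let ?R = "remainder k t T"
  let ?v = "procedure_output k t T N"
  have v: "?v \<in> exp_space k t" by (rule procedure_output_in_exp_space)
  have "k < 0" using assms(2) by (simp add: in_case1_def)
  \<comment> \<open>The final remainder is the result of a step applied to a vector in case 1, hence
    centred.\<close>
  obtain s where s: "N = Suc s" using N(1) by (cases N) auto
  then have "in_case1 k (?R s)" using N(2) by (simp add: procedure_stops_after_def)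
  from remainder_step(3)[OF assms(1) this]
  have "vmax (?R N) = - vmin (?R N)" by (simp add: s)
  then have centred: "vmax (T - ?v) = - vmin (T - ?v)" unfolding remainder_eq .
  have "finished (T - ?v)"
    using N(2) by (simp add: procedure_stops_after_def flip: remainder_eq)
  then have "best_approximation k t T ?v"
    unfolding finished_def
  proof
    assume "alternated (T - ?v)"
    with assms(1) \<open>k < 0\<close> v show ?thesis
      using centred by (rule best_approximation_of_alternated)
  next
    assume "T - ?v = 0"
    then show ?thesis using v best_approximation_self[of T k t] by simp
  qed
  with N(2) show ?thesis by blast
qed

end
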